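(* Let $G$ be a simple undirected graph on the vertex set $[n]=\{1,\dots,n\}$, let $t$ be the number of triangles in $G$, and let $t_{\max}$ be the maximum, over vertices $v$ of $G$, of the number of triangles of $G$ containing $v$. Let $N$ be a positive integer and $p=1/N$. Color each vertex of $G$ independently and uniformly at random with one of $N$ colors (so each vertex receives any given color with probability $p$), and let $T$ be the number of monochromatic triangles, i.e. triangles of $G$ all three of whose vertices receive the same color. Let $\epsilon$ be a small positive constant and $d>0$ any constant. If $$p^2 \geq \frac{4(d+3)\, t_{\max} \log n}{\epsilon^2 t},$$ then $$\Pr\big[\, |T-\mathbb{E}[T]| > \epsilon\, \mathbb{E}[T]\,\big] \leq \frac{1}{n^d}.$$
   Context: Here $\mathbb{E}[T]=p^2 t$. This random coloring is the sampling step of the "colorful triangle sampling" algorithm, which keeps exactly the monochromatic edges (edges whose endpoints receive the same color), counts the triangles $T$ among them, and outputs $T/p^2$ as an estimate of $t$. *)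

theory Defs
  imports "HOL-Probability.Probability"
begin

definition simple_graph_on :: "nat \<Rightarrow> (nat \<Rightarrow> nat \<Rightarrow> bool) \<Rightarrow> bool" where
  "simple_graph_on n E \<longleftrightarrow>
     (\<forall>u\<in>{1..n}. \<forall>v\<in>{1..n}. E u v \<longleftrightarrow> E v u) \<and> (\<forall>v\<in>{1..n}. \<not> E v v)"

definition triangles :: "nat \<Rightarrow> (nat \<Rightarrow> nat \<Rightarrow> bool) \<Rightarrow> nat set set" where
  "triangles n E = {S. S \<subseteq> {1..n} \<and> card S = 3 \<and> (\<forall>x\<in>S. \<forall>y\<in>S. x \<noteq> y \<longrightarrow> E x y)}"

definition num_triangles :: "nat \<Rightarrow> (nat \<Rightarrow> nat \<Rightarrow> bool) \<Rightarrow> nat" where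
  "num_triangles n E = card (triangles n E)"

definition max_vertex_triangles :: "nat \<Rightarrow> (nat \<Rightarrow> nat \<Rightarrow> bool) \<Rightarrow> nat" where
  "max_vertex_triangles n E =
     Max (insert 0 ((\<lambda>v. card {S \<in> triangles n E. v \<in> S}) ` {1..n}))"

text \<open>All colorings of [n] with N colors {0..<N}; the uniform distribution on them is
exactly independent uniform coloring of each vertex.\<close>
definition colorings :: "nat \<Rightarrow> nat \<Rightarrow> (nat \<Rightarrow> nat) set" where
  "colorings n N = PiE {1..n} (\<lambda>_. {..<N})"

definition random_coloring :: "nat \<Rightarrow> nat \<Rightarrow> (nat \<Rightarrow> nat) pmf" where
  "random_coloring n N = pmf_of_set (colorings n N)"

definition mono_triangles :: "nat \<Rightarrow> (nat \<Rightarrow> nat \<Rightarrow> bool) \<Rightarrow> (nat \<Rightarrow> nat) \<Rightarrow> nat" where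
  "mono_triangles n E c = card {S \<in> triangles n E. \<forall>x\<in>S. \<forall>y\<in>S. c x = c y}"

end

theory Submission
  imports Defs
begin

text \<open>
  Expose the colors one vertex at a time. With \<open>K = t\<^bsub>max\<^esub>\<close> and \<open>\<bar>u\<bar> \<le> 1/2\<close>, let a triangle with
  \<open>k\<close> exposed vertices have weight \<open>w k\<close> as long as these have the same color, and \<open>0\<close> afterwards,
  where \<open>w 3 = u\<close>, \<open>w 2 = h u\<close>, \<open>w 1 = w 0 = h (h u)\<close> and \<open>h x = p x + 2/3 p (1 - p) x\<^sup>2\<close>.
  A newly exposed vertex affects at most \<open>K\<close> triangles, and Cauchy-Schwarz within each color class
  together with the variance of the new color shows that the exponential of the total weight divided
  by \<open>K\<close> is a supermartingale. Hence \<open>ln E[exp (u T / K)] \<le> t h (h u) / K \<le> (u + u\<^sup>2) E[T] / K\<close>, and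
  Markov's inequality at \<open>u = \<plusminus>\<epsilon>/2\<close> bounds each tail by
  \<open>exp (- \<epsilon>\<^sup>2 E[T] / (4 K)) \<le> n\<^bsup>-(d+3)\<^esup>\<close>. Decomposing the triangles into independent classes and applying
  a Chernoff bound to each would not reach the constant \<open>4\<close>.
\<close>

section \<open>Monochromatic sets under the coloring of one further vertex\<close>

definition monochromatic :: "('a \<Rightarrow> 'b) \<Rightarrow> 'a set \<Rightarrow> bool" where
  "monochromatic c S \<longleftrightarrow> (\<forall>x\<in>S. \<forall>y\<in>S. c x = c y)"

lemma monochromatic_insert_upd:
  assumes "v \<notin> A"
  shows "monochromatic (c(v := j)) (insert v A) \<longleftrightarrow> monochromatic c A \<and> (\<forall>x\<in>A. c x = j)"
  using assms unfolding monochromatic_def by (auto simp: fun_upd_apply split: if_splits)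

lemma monochromatic_upd_other:
  assumes "v \<notin> A"
  shows "monochromatic (c(v := j)) A \<longleftrightarrow> monochromatic c A"
  using assms unfolding monochromatic_def by (auto simp: fun_upd_apply split: if_splits)

text \<open>Serves to expose one vertex at a time: both inductions over the vertex set, for the
  exponential moment and for the mean, start from this split.\<close>

lemma sum_PiE_insert:
  assumes "v \<notin> U"
  shows "(\<Sum>c\<in>PiE (insert v U) (\<lambda>_. B). f c) = (\<Sum>c\<in>PiE U (\<lambda>_. B). \<Sum>j\<in>B. f (c(v := j)))"
proof -
  have "(\<Sum>c\<in>PiE (insert v U) (\<lambda>_. B). f c) = (\<Sum>(j, c)\<in>B \<times> PiE U (\<lambda>_. B). f (c(v := j)))"
    unfolding PiE_insert_eq
    by (subst sum.reindex[OF inj_combinator[OF assms]]) (simp add: case_prod_unfold)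
  then show ?thesis
    by (simp add: sum.cartesian_product[symmetric] sum.swap[of _ B])
qed

section \<open>Exponential moment of one random color\<close>

text \<open>The constant is 2/3 = 1/2 + 1/6: the second Taylor term gives 1/2, and in the Lagrange
  remainder \<open>exp t / 6 * x ^ 3\<close> the factor \<open>exp t * x\<close> is at most 2 * 1/2
  = 1.\<close>

lemma exp_le_quadratic:
  fixes x :: real
  assumes "\<bar>x\<bar> \<le> 1/2"
  shows "exp x \<le> 1 + x + 2/3 * x\<^sup>2"
proof -
  obtain t where t: "\<bar>t\<bar> \<le> \<bar>x\<bar>" "exp x = (\<Sum>m<3. x ^ m / fact m) + exp t / fact 3 * x ^ 3"
    using Maclaurin_exp_le by blast
  have e: "exp x = 1 + x + x\<^sup>2 / 2 + exp t / 6 * (x * x\<^sup>2)"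
    using t(2) by (simp add: eval_nat_numeral field_simps)
  have "exp t \<le> exp (1/2)" using t(1) assms by simp
  also have "\<dots> \<le> 2" using exp_bound_half[of "1/2::real"] by simp
  finally have "exp t \<le> 2" .
  then have "exp t * x \<le> 1"
    using mult_mono[of "exp t" 2 x "1/2"] assms mult_nonneg_nonpos[of "exp t" x]
    by (cases "x \<ge> 0") auto
  then have "exp t * x * x\<^sup>2 \<le> 1 * x\<^sup>2" by (rule mult_right_mono) simp
  then have "exp t / 6 * (x * x\<^sup>2) \<le> x\<^sup>2 / 6" by (simp add: mult.assoc)
  then show ?thesis unfolding e by linarith
qed

text \<open>Centering at the mean \<open>m\<close> removes the linear term of the quadratic bound,
  so only the variance is left. As all values have one sign, the variance is at most
  \<open>p * (1 - p)\<close> times the sum of squares. The factor \<open>1 - p\<close> is what later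
  keeps the accumulated quadratic term small when \<open>p\<close> is not small.\<close>

lemma mean_exp_le:
  fixes X :: "nat \<Rightarrow> real"
  assumes N: "N > 0" and p: "p = 1 / real N"
    and X: "(\<forall>j<N. 0 \<le> X j \<and> X j \<le> 1/2) \<or> (\<forall>j<N. -1/2 \<le> X j \<and> X j \<le> 0)"
  shows "p * (\<Sum>j<N. exp (X j)) \<le> exp (p * (\<Sum>j<N. X j) + 2/3 * p * (1 - p) * (\<Sum>j<N. (X j)\<^sup>2))"
proof -
  define m where "m = p * (\<Sum>j<N. X j)"
  have pN: "p * real N = 1" and p0: "p > 0" using N p by auto
  \<comment> \<open>The values and their mean share an interval of length 1/2, so the quadratic
    bound applies to the centered values.\<close>
  have dev: "\<bar>X j - m\<bar> \<le> 1/2" if "j < N" for j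
    using X
  proof
    assume a: "\<forall>j<N. 0 \<le> X j \<and> X j \<le> 1/2"
    have "(\<Sum>j<N. X j) \<le> real N * (1/2)" using sum_bounded_above[of "{..<N}" X "1/2"] a by simp
    then have "m \<le> p * (real N * (1/2))" unfolding m_def using p0 by simp
    then have "m \<le> 1/2" using pN by simp
    moreover have "m \<ge> 0" unfolding m_def using a p0 by (intro mult_nonneg_nonneg sum_nonneg) auto
    moreover have "0 \<le> X j" "X j \<le> 1/2" using a that by auto
    ultimately show ?thesis by linarith
  next
    assume a: "\<forall>j<N. -1/2 \<le> X j \<and> X j \<le> 0"
    have "(\<Sum>j<N. X j) \<ge> real N * (-1/2)" using sum_bounded_below[of "{..<N}" "-1/2" X] a by simp
    then have "m \<ge> p * (real N * (-1/2))" unfolding m_def using p0 by (simp only: mult_le_cancel_left_pos)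
    then have "m \<ge> -1/2" using pN by simp
    moreover have "m \<le> 0" unfolding m_def using a p0 by (intro mult_nonneg_nonpos sum_nonpos) auto
    moreover have "-1/2 \<le> X j" "X j \<le> 0" using a that by auto
    ultimately show ?thesis by linarith
  qed
  \<comment> \<open>All cross products \<open>X j * X i\<close> are nonnegative because the signs
    agree. This bounds \<open>m\<^sup>2\<close> from below in the variance.\<close>
  have "(\<Sum>j<N. (X j)\<^sup>2) \<le> (\<Sum>j<N. X j)\<^sup>2"
  proof -
    have "(X j)\<^sup>2 \<le> X j * (\<Sum>i<N. X i)" if "j < N" for j
      using X
    proof
      assume a: "\<forall>j<N. 0 \<le> X j \<and> X j \<le> 1/2"
      have "X j \<le> (\<Sum>i<N. X i)" by (rule member_le_sum) (use a that in auto)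
      then show ?thesis using a that by (simp add: power2_eq_square mult_left_mono)
    next
      assume a: "\<forall>j<N. -1/2 \<le> X j \<and> X j \<le> 0"
      have "- X j \<le> (\<Sum>i<N. - X i)" by (rule member_le_sum) (use a that in auto)
      then show ?thesis using a that by (simp add: power2_eq_square mult_left_mono_neg sum_negf)
    qed
    then have "(\<Sum>j<N. (X j)\<^sup>2) \<le> (\<Sum>j<N. X j * (\<Sum>i<N. X i))" by (intro sum_mono) auto
    then show ?thesis by (simp add: power2_eq_square sum_distrib_right)
  qed
  then have sq: "p\<^sup>2 * (\<Sum>j<N. (X j)\<^sup>2) \<le> m\<^sup>2"
    unfolding m_def power_mult_distrib by (intro mult_left_mono) auto
  have "(\<Sum>j<N. (X j - m)\<^sup>2) = (\<Sum>j<N. (X j)\<^sup>2) - 2 * m * (\<Sum>j<N. X j) + real N * m\<^sup>2"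
    by (simp add: power2_diff sum.distrib sum_subtractf sum_distrib_left mult_ac)
  then have "p * (\<Sum>j<N. (X j - m)\<^sup>2) = p * (\<Sum>j<N. (X j)\<^sup>2) - 2 * m * (p * (\<Sum>j<N. X j)) + (p * real N) * m\<^sup>2"
    by (simp only: ring_distribs right_diff_distrib mult_ac)
  also have "\<dots> = p * (\<Sum>j<N. (X j)\<^sup>2) - m\<^sup>2"
    unfolding pN m_def[symmetric] by (simp add: power2_eq_square)
  also have "\<dots> \<le> p * (1 - p) * (\<Sum>j<N. (X j)\<^sup>2)"
    using sq by (simp add: algebra_simps power2_eq_square)
  finally have var: "p * (\<Sum>j<N. (X j - m)\<^sup>2) \<le> p * (1 - p) * (\<Sum>j<N. (X j)\<^sup>2)" .
  have "p * (\<Sum>j<N. exp (X j)) = exp m * (p * (\<Sum>j<N. exp (X j - m)))"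
    by (simp add: exp_diff sum_divide_distrib[symmetric])
  also have "p * (\<Sum>j<N. exp (X j - m)) \<le> p * (\<Sum>j<N. 1 + (X j - m) + 2/3 * (X j - m)\<^sup>2)"
    using p0 dev exp_le_quadratic by (intro mult_left_mono sum_mono) auto
  also have "\<dots> = p * real N + (p * (\<Sum>j<N. X j) - (p * real N) * m) + 2/3 * (p * (\<Sum>j<N. (X j - m)\<^sup>2))"
    by (simp only: sum.distrib sum_subtractf sum_distrib_left[symmetric] sum_constant card_lessThan
        ring_distribs right_diff_distrib mult_ac mult_1_right)
  also have "\<dots> = 1 + 2/3 * (p * (\<Sum>j<N. (X j - m)\<^sup>2))"
    unfolding pN m_def[symmetric] by simp
  also have "\<dots> \<le> 1 + 2/3 * (p * (1 - p) * (\<Sum>j<N. (X j)\<^sup>2))" using var by simp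
  also have "\<dots> \<le> exp (2/3 * (p * (1 - p) * (\<Sum>j<N. (X j)\<^sup>2)))" by (rule exp_ge_add_one_self)
  finally show ?thesis by (simp add: m_def exp_add mult.assoc)
qed

text \<open>Here \<open>G\<close> stands for the sets that the new vertex may keep alive, and
  \<open>q S\<close> for the one color that does so. A fibre of \<open>q\<close> has at most
  \<open>K\<close> members, so division by \<open>K\<close> keeps the fibre sums in the range of
  \<open>mean_exp_le\<close>. Cauchy-Schwarz on a fibre costs a factor \<open>K\<close>, which
  cancels one of the two in \<open>1 / K\<^sup>2\<close>; the exponent thus becomes a sum of
  separate terms over \<open>G\<close>, again divided by \<open>K\<close>.\<close>

lemma mean_exp_fibre_sums_le:
  fixes y :: "'s \<Rightarrow> real" and q :: "'s \<Rightarrow> nat"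
  assumes N: "N > 0" and p: "p = 1 / real N"
    and G: "finite G" "card G \<le> K" and K: "K > 0"
    and q: "\<And>S. S \<in> G \<Longrightarrow> q S < N"
    and y: "(\<forall>S\<in>G. 0 \<le> y S \<and> y S \<le> 1/2) \<or> (\<forall>S\<in>G. -1/2 \<le> y S \<and> y S \<le> 0)"
  shows "p * (\<Sum>j<N. exp ((\<Sum>S | S \<in> G \<and> q S = j. y S) / real K))
         \<le> exp ((\<Sum>S\<in>G. p * y S + 2/3 * p * (1 - p) * (y S)\<^sup>2) / real K)"
proof -
  define X where "X j = (\<Sum>S | S \<in> G \<and> q S = j. y S) / real K" for j
  have cK: "real (card {S \<in> G. q S = j}) \<le> real K" for j
    using card_mono[of G "{S \<in> G. q S = j}"] G by auto
  have fibre: "(\<Sum>j<N. \<Sum>S | S \<in> G \<and> q S = j. f S) = (\<Sum>S\<in>G. f S)" for f :: "'s \<Rightarrow> real"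
    using G(1) q by (intro sum.group) auto
  have X: "(\<forall>j<N. 0 \<le> X j \<and> X j \<le> 1/2) \<or> (\<forall>j<N. -1/2 \<le> X j \<and> X j \<le> 0)"
    using y
  proof (rule disj_forward)
    assume a: "\<forall>S\<in>G. 0 \<le> y S \<and> y S \<le> 1/2"
    have "(\<Sum>S | S \<in> G \<and> q S = j. y S) \<le> real (card {S \<in> G. q S = j}) * (1/2)" for j
      using sum_bounded_above[of "{S \<in> G. q S = j}" y "1/2"] a by simp
    then have "(\<Sum>S | S \<in> G \<and> q S = j. y S) \<le> real K * (1/2)" for j
      by (rule order_trans) (use cK[of j] in simp)
    then show "\<forall>j<N. 0 \<le> X j \<and> X j \<le> 1/2"
      unfolding X_def using a K by (auto simp: field_simps intro!: sum_nonneg divide_nonneg_nonneg)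
  next
    assume a: "\<forall>S\<in>G. -1/2 \<le> y S \<and> y S \<le> 0"
    have "(\<Sum>S | S \<in> G \<and> q S = j. - y S) \<le> real (card {S \<in> G. q S = j}) * (1/2)" for j
      using sum_bounded_above[of "{S \<in> G. q S = j}" "\<lambda>S. - y S" "1/2"] a by fastforce
    then have "(\<Sum>S | S \<in> G \<and> q S = j. - y S) \<le> real K * (1/2)" for j
      by (rule order_trans) (use cK[of j] in simp)
    then have neg: "- (\<Sum>S | S \<in> G \<and> q S = j. y S) \<le> real K * (1/2)" for j
      unfolding sum_negf .
    have "real K * (-1/2) \<le> (\<Sum>S | S \<in> G \<and> q S = j. y S)" for j
      using neg[of j] by linarith
    then have "-1/2 \<le> X j" for j
      unfolding X_def using K by (subst pos_le_divide_eq) (auto simp: mult.commute)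
    moreover have "X j \<le> 0" for j
      unfolding X_def using a by (intro divide_nonpos_nonneg sum_nonpos) auto
    ultimately show "\<forall>j<N. -1/2 \<le> X j \<and> X j \<le> 0" by blast
  qed
  have Xsq: "(X j)\<^sup>2 \<le> (\<Sum>S | S \<in> G \<and> q S = j. (y S)\<^sup>2) / real K" for j
  proof -
    have "(\<Sum>S | S \<in> G \<and> q S = j. 1 * y S)\<^sup>2
          \<le> (\<Sum>S | S \<in> G \<and> q S = j. 1\<^sup>2) * (\<Sum>S | S \<in> G \<and> q S = j. (y S)\<^sup>2)"
      by (rule Cauchy_Schwarz_ineq_sum)
    also have "\<dots> \<le> real K * (\<Sum>S | S \<in> G \<and> q S = j. (y S)\<^sup>2)"
      using cK[of j] by (auto intro!: mult_right_mono sum_nonneg)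
    finally show ?thesis
      unfolding X_def using K by (simp add: power_divide power2_eq_square[of "real K"] field_simps)
  qed
  have p01: "p > 0" "p \<le> 1" using N p by auto
  have "p * (\<Sum>j<N. X j) + 2/3 * p * (1 - p) * (\<Sum>j<N. (X j)\<^sup>2)
        \<le> p * (\<Sum>j<N. X j) + 2/3 * p * (1 - p) * (\<Sum>j<N. (\<Sum>S | S \<in> G \<and> q S = j. (y S)\<^sup>2) / real K)"
    using p01 Xsq by (intro add_left_mono mult_left_mono sum_mono) auto
  also have "\<dots> = (\<Sum>S\<in>G. p * y S + 2/3 * p * (1 - p) * (y S)\<^sup>2) / real K"
    unfolding X_def sum_divide_distrib[symmetric] fibre
    by (simp only: sum.distrib sum_distrib_left[symmetric] add_divide_distrib times_divide_eq_right)
  finally have "exp (p * (\<Sum>j<N. X j) + 2/3 * p * (1 - p) * (\<Sum>j<N. (X j)\<^sup>2))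
        \<le> exp ((\<Sum>S\<in>G. p * y S + 2/3 * p * (1 - p) * (y S)\<^sup>2) / real K)" by simp
  then show ?thesis using mean_exp_le[OF N p X] unfolding X_def by linarith
qed

section \<open>The supermartingale over exposed vertices\<close>

text \<open>Induction on the exposed set \<open>U\<close>: given a coloring of \<open>U\<close>,
  averaging over the color of the next vertex does not increase the exponential. \<open>w01\<close>
  says that the first exposed vertex of a set is free, since it fits any color, and
  \<open>wstep\<close> pays for each later one. The sums are unnormalized, hence the factor
  \<open>real N ^ card U\<close>.\<close>

lemma sum_exp_potential_le:
  fixes w :: "nat \<Rightarrow> real" and F :: "'a set set"
  assumes N: "N > 0" and p: "p = 1 / real N" and K: "K > 0"
    and F: "finite F" "\<And>v. card {S \<in> F. v \<in> S} \<le> K" "\<And>S. S \<in> F \<Longrightarrow> finite S \<and> card S \<le> r"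
    and w01: "w 0 = w 1"
    and wstep: "\<And>k. 1 \<le> k \<Longrightarrow> k < r \<Longrightarrow> p * w (Suc k) + 2/3 * p * (1 - p) * (w (Suc k))\<^sup>2 \<le> w k"
    and w: "(\<forall>k. 0 \<le> w k \<and> w k \<le> 1/2) \<or> (\<forall>k. -1/2 \<le> w k \<and> w k \<le> 0)"
    and U: "finite U"
  shows "(\<Sum>c\<in>PiE U (\<lambda>_. {..<N}).
            exp ((\<Sum>S\<in>F. if monochromatic c (S \<inter> U) then w (card (S \<inter> U)) else 0) / real K))
         \<le> real N ^ card U * exp (real (card F) * w 0 / real K)"
  using U
proof (induction U rule: finite_induct)
  case empty
  then show ?case by (simp add: monochromatic_def)
next
  case (insert v U)
  define \<psi> where "\<psi> U c S = (if monochromatic c (S \<inter> U) then w (card (S \<inter> U)) else 0)"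
    for U and c :: "'a \<Rightarrow> nat" and S
  have step: "(\<Sum>j<N. exp ((\<Sum>S\<in>F. \<psi> (insert v U) (c(v := j)) S) / real K))
              \<le> real N * exp ((\<Sum>S\<in>F. \<psi> U c S) / real K)"
    if c: "c \<in> PiE U (\<lambda>_. {..<N})" for c
  proof -
    \<comment> \<open>Exactly these sets can react to the color of \<open>v\<close>. The others
      avoid \<open>v\<close>, are already broken, or receive their first exposed vertex.\<close>
    define G where "G = {S \<in> F. v \<in> S \<and> S \<inter> U \<noteq> {} \<and> monochromatic c (S \<inter> U)}"
    \<comment> \<open>Any exposed vertex of \<open>S\<close> may be chosen, since for
      \<open>S\<close> in \<open>G\<close> they all have the same color.\<close>
    define q where "q S = c (SOME x. x \<in> S \<inter> U)" for S
    define y where "y S = w (Suc (card (S \<inter> U)))" for S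
    define C where "C = (\<Sum>S\<in>F - G. \<psi> U c S)"
    have GF: "G \<subseteq> F" "finite G" using F(1) by (auto simp: G_def)
    have cG: "card G \<le> K"
      using F(1) by (intro order_trans[OF card_mono F(2)[of v]]) (auto simp: G_def)
    have qU: "(SOME x. x \<in> S \<inter> U) \<in> S \<inter> U" if "S \<in> G" for S
      using that unfolding some_in_eq by (simp add: G_def)
    have qN: "q S < N" if "S \<in> G" for S
      using qU[OF that] c unfolding q_def by (auto simp: PiE_def Pi_def)
    have new: "\<psi> (insert v U) (c(v := j)) S = (if q S = j then y S else 0)" if "S \<in> G" for S j
    proof -
      have eq: "S \<inter> insert v U = insert v (S \<inter> U)" using that by (auto simp: G_def)
      have "(\<forall>x\<in>S \<inter> U. c x = j) \<longleftrightarrow> q S = j"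
        using qU[OF that] that unfolding q_def G_def monochromatic_def by blast
      moreover have "v \<notin> S \<inter> U" using insert.hyps by auto
      ultimately show ?thesis
        using that insert.hyps unfolding \<psi>_def eq y_def G_def
        by (simp add: monochromatic_insert_upd)
    qed
    have old: "\<psi> (insert v U) (c(v := j)) S = \<psi> U c S" if S: "S \<in> F - G" for S j
    proof (cases "v \<in> S")
      case False
      then have "S \<inter> insert v U = S \<inter> U" by auto
      then show ?thesis
        using insert.hyps by (simp add: \<psi>_def monochromatic_upd_other)
    next
      case True
      then have eq: "S \<inter> insert v U = insert v (S \<inter> U)" by auto
      have v: "v \<notin> S \<inter> U" using insert.hyps by auto
      consider "S \<inter> U = {}" | "\<not> monochromatic c (S \<inter> U)"
        using S True by (auto simp: G_def)
      then show ?thesis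
      proof cases
        case 1
        then show ?thesis using w01 unfolding \<psi>_def eq by (simp add: monochromatic_def)
      next
        case 2
        then show ?thesis unfolding \<psi>_def eq by (simp add: monochromatic_insert_upd[OF v])
      qed
    qed
    have split: "(\<Sum>S\<in>F. \<psi> (insert v U) (c(v := j)) S) = C + (\<Sum>S | S \<in> G \<and> q S = j. y S)" for j
    proof -
      have "(\<Sum>S\<in>F. \<psi> (insert v U) (c(v := j)) S)
            = (\<Sum>S\<in>F - G. \<psi> (insert v U) (c(v := j)) S) + (\<Sum>S\<in>G. \<psi> (insert v U) (c(v := j)) S)"
        by (rule sum.subset_diff[OF GF(1) F(1)])
      also have "\<dots> = C + (\<Sum>S\<in>G. if q S = j then y S else 0)"
        unfolding C_def using old new by simp
      finally show ?thesis unfolding sum.inter_filter[OF GF(2)] .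
    qed
    \<comment> \<open>For \<open>S\<close> in \<open>G\<close> the exposed part is nonempty and
      misses \<open>v\<close>, so its size lies between 1 and \<open>r - 1\<close>, the range of
      \<open>wstep\<close>.\<close>
    have "p * y S + 2/3 * p * (1 - p) * (y S)\<^sup>2 \<le> \<psi> U c S" if S: "S \<in> G" for S
    proof -
      have "S \<in> F" "v \<in> S" "S \<inter> U \<noteq> {}" using S by (auto simp: G_def)
      then have "finite S" "card S \<le> r" using F(3) by auto
      have "S \<inter> U \<subset> S" using \<open>v \<in> S\<close> insert.hyps by auto
      then have "card (S \<inter> U) < r"
        using psubset_card_mono[OF \<open>finite S\<close>, of "S \<inter> U"] \<open>card S \<le> r\<close> by linarith
      moreover have "1 \<le> card (S \<inter> U)"
        using \<open>S \<inter> U \<noteq> {}\<close> \<open>finite S\<close> by (simp add: Suc_le_eq card_gt_0_iff)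
      ultimately show ?thesis using S wstep by (simp add: \<psi>_def y_def G_def)
    qed
    then have "(\<Sum>S\<in>G. p * y S + 2/3 * p * (1 - p) * (y S)\<^sup>2) \<le> (\<Sum>S\<in>G. \<psi> U c S)"
      by (rule sum_mono)
    then have "exp ((\<Sum>S\<in>G. p * y S + 2/3 * p * (1 - p) * (y S)\<^sup>2) / real K)
               \<le> exp ((\<Sum>S\<in>G. \<psi> U c S) / real K)"
      using K by (simp add: divide_right_mono)
    moreover have "p * (\<Sum>j<N. exp ((\<Sum>S | S \<in> G \<and> q S = j. y S) / real K))
        \<le> exp ((\<Sum>S\<in>G. p * y S + 2/3 * p * (1 - p) * (y S)\<^sup>2) / real K)"
      using w by (intro mean_exp_fibre_sums_le N p GF cG K qN) (auto simp: y_def)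
    ultimately have "p * (\<Sum>j<N. exp ((\<Sum>S | S \<in> G \<and> q S = j. y S) / real K))
        \<le> exp ((\<Sum>S\<in>G. \<psi> U c S) / real K)" by linarith
    then have "(\<Sum>j<N. exp ((\<Sum>S | S \<in> G \<and> q S = j. y S) / real K))
        \<le> real N * exp ((\<Sum>S\<in>G. \<psi> U c S) / real K)"
      using N unfolding p by (simp add: field_simps)
    then have "exp (C / real K) * (\<Sum>j<N. exp ((\<Sum>S | S \<in> G \<and> q S = j. y S) / real K))
        \<le> exp (C / real K) * (real N * exp ((\<Sum>S\<in>G. \<psi> U c S) / real K))"
      by (intro mult_left_mono) auto
    moreover have "(\<Sum>S\<in>F. \<psi> U c S) = C + (\<Sum>S\<in>G. \<psi> U c S)"
      unfolding C_def by (rule sum.subset_diff[OF GF(1) F(1)])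
    ultimately show ?thesis
      unfolding split by (simp add: add_divide_distrib exp_add sum_distrib_left mult_ac)
  qed
  have "(\<Sum>c\<in>PiE (insert v U) (\<lambda>_. {..<N}). exp ((\<Sum>S\<in>F. \<psi> (insert v U) c S) / real K))
        = (\<Sum>c\<in>PiE U (\<lambda>_. {..<N}). \<Sum>j<N. exp ((\<Sum>S\<in>F. \<psi> (insert v U) (c(v := j)) S) / real K))"
    using insert.hyps by (intro sum_PiE_insert)
  also have "\<dots> \<le> (\<Sum>c\<in>PiE U (\<lambda>_. {..<N}). real N * exp ((\<Sum>S\<in>F. \<psi> U c S) / real K))"
    by (intro sum_mono step)
  also have "\<dots> = real N * (\<Sum>c\<in>PiE U (\<lambda>_. {..<N}). exp ((\<Sum>S\<in>F. \<psi> U c S) / real K))"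
    by (simp add: sum_distrib_left)
  also have "\<dots> \<le> real N * (real N ^ card U * exp (real (card F) * w 0 / real K))"
    using insert.IH unfolding \<psi>_def by (intro mult_left_mono) auto
  finally show ?case using insert.hyps unfolding \<psi>_def by (simp add: mult_ac)
qed

section \<open>The mean, and Markov's inequality for exponentials\<close>

text \<open>Each exposed vertex of \<open>S\<close> after the first must repeat the color already
  used. Truncated subtraction also gives the right exponent 0 when \<open>S\<close> does not meet
  \<open>U\<close>.\<close>

lemma sum_monochromatic:
  assumes N: "N > 0" and U: "finite U"
  shows "(\<Sum>c\<in>PiE U (\<lambda>_. {..<N}). of_bool (monochromatic c (S \<inter> U)) :: real)
         = real N ^ card U * (1 / real N) ^ (card (S \<inter> U) - 1)"
  using U
proof (induction U rule: finite_induct)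
  case empty
  then show ?case by (simp add: monochromatic_def)
next
  case (insert v U)
  have v: "v \<notin> S \<inter> U" using insert.hyps by auto
  have fin: "finite (S \<inter> U)" using insert.hyps by auto
  have sum: "(\<Sum>c\<in>PiE (insert v U) (\<lambda>_. {..<N}). of_bool (monochromatic c (S \<inter> insert v U)) :: real)
        = (\<Sum>c\<in>PiE U (\<lambda>_. {..<N}). \<Sum>j<N. of_bool (monochromatic (c(v := j)) (S \<inter> insert v U)))"
    using insert.hyps by (intro sum_PiE_insert)
  consider "v \<notin> S" | "v \<in> S" "S \<inter> U = {}" | "v \<in> S" "S \<inter> U \<noteq> {}" by blast
  then show ?case
  proof cases
    case 1
    then have "S \<inter> insert v U = S \<inter> U" by auto
    then show ?thesis
      unfolding sum using insert v by (simp add: monochromatic_upd_other sum_distrib_left[symmetric])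
  next
    case 2
    then have "S \<inter> insert v U = {v}" by auto
    then show ?thesis
      unfolding sum using insert.hyps by (simp add: monochromatic_def card_PiE)
  next
    case 3
    then have eq: "S \<inter> insert v U = insert v (S \<inter> U)" by auto
    obtain x where x: "x \<in> S \<inter> U" using 3 by auto
    \<comment> \<open>Among the \<open>N\<close> colors of \<open>v\<close> only \<open>c x\<close>
      can keep the set monochromatic.\<close>
    have "(\<Sum>j<N. of_bool (monochromatic (c(v := j)) (S \<inter> insert v U)) :: real)
          = of_bool (monochromatic c (S \<inter> U))" if c: "c \<in> PiE U (\<lambda>_. {..<N})" for c
    proof -
      have "c x < N" using c x by (auto simp: PiE_def Pi_def)
      moreover have "monochromatic (c(v := j)) (S \<inter> insert v U) \<longleftrightarrow> monochromatic c (S \<inter> U) \<and> j = c x" for j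
        unfolding eq monochromatic_insert_upd[OF v] using x by (auto simp: monochromatic_def)
      ultimately show ?thesis
        by (simp add: of_bool_conj sum_distrib_left[symmetric] of_bool_def)
    qed
    then have "(\<Sum>c\<in>PiE (insert v U) (\<lambda>_. {..<N}). of_bool (monochromatic c (S \<inter> insert v U)) :: real)
        = real N ^ card U * (1 / real N) ^ (card (S \<inter> U) - 1)"
      unfolding sum using insert.IH by simp
    moreover obtain k where "card (S \<inter> U) = Suc k"
      using x fin by (metis card_gt_0_iff empty_iff gr0_implies_Suc)
    ultimately show ?thesis
      unfolding eq using v fin insert.hyps N by simp
  qed
qed

text \<open>The indicator of \<open>P\<close> is at most \<open>exp (g x)\<close> on
  \<open>A\<close>; this is Markov's inequality with the threshold absorbed into
  \<open>g\<close>.\<close>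

lemma prob_pmf_of_set_exp_le:
  assumes A: "finite A" "A \<noteq> {}" and g: "\<And>x. x \<in> A \<Longrightarrow> P x \<Longrightarrow> g x \<ge> (0::real)"
  shows "measure_pmf.prob (pmf_of_set A) {x. P x} \<le> (\<Sum>x\<in>A. exp (g x)) / real (card A)"
proof -
  have "real (card (A \<inter> {x. P x})) = (\<Sum>x\<in>A. of_bool (P x))"
    using A by simp
  also have "\<dots> \<le> (\<Sum>x\<in>A. exp (g x))"
    using g by (intro sum_mono) (auto simp: of_bool_def)
  finally show ?thesis using A by (simp add: measure_pmf_of_set divide_right_mono)
qed

section \<open>Two backward steps of the weight recursion\<close>

text \<open>One step multiplies \<open>u\<close> by a factor \<open>r\<close> in [0, 1], since
  \<open>r\<close> is at most \<open>1 - (1 - p)\<^sup>2\<close>. So all weights keep the sign of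
  \<open>u\<close> and stay within 1/2, as the one-sign hypotheses above demand.\<close>

lemma exponent_step_bounds:
  fixes p u :: real
  assumes p: "0 < p" "p \<le> 1" and u: "\<bar>u\<bar> \<le> 1/2"
  defines "h \<equiv> p * u + 2/3 * p * (1 - p) * u\<^sup>2"
  shows "0 \<le> u \<Longrightarrow> 0 \<le> h \<and> h \<le> u" and "u \<le> 0 \<Longrightarrow> u \<le> h \<and> h \<le> 0"
proof -
  define z where "z = (1 - p) * u"
  define r where "r = p * (1 + 2/3 * z)"
  have h: "h = r * u" unfolding h_def r_def z_def by (simp add: algebra_simps power2_eq_square)
  have "\<bar>z\<bar> \<le> (1 - p) * (1/2)"
    unfolding z_def abs_mult using p u by (intro mult_mono) auto
  then have b: "0 \<le> 1 + 2/3 * z" "1 + 2/3 * z \<le> 1 + (1 - p)"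
    using p by (simp_all add: abs_le_iff)
  have "r \<le> p * (1 + (1 - p))" unfolding r_def using p b by (intro mult_left_mono) auto
  also have "\<dots> = 1 - (1 - p)\<^sup>2" by (simp add: power2_eq_square algebra_simps)
  also have "\<dots> \<le> 1" by simp
  finally have r: "0 \<le> r" "r \<le> 1" unfolding r_def using p b by auto
  show "0 \<le> h \<and> h \<le> u" if "0 \<le> u"
    unfolding h using r that by (simp add: mult_left_le_one_le)
  show "u \<le> h \<and> h \<le> 0" if "u \<le> 0"
    unfolding h using r that mult_right_mono_neg[of r 1 u] by (simp add: mult_nonneg_nonpos)
qed

lemma exponent_two_steps_le:
  fixes p u :: real
  assumes p: "0 < p" "p \<le> 1" and u: "\<bar>u\<bar> \<le> 1/2"
  defines "h \<equiv> \<lambda>x. p * x + 2/3 * p * (1 - p) * x\<^sup>2"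
  shows "h (h u) \<le> p\<^sup>2 * (u + u\<^sup>2)"
proof -
  define b where "b = 1 + 2/3 * (1 - p) * u"
  have "\<bar>(1 - p) * u\<bar> \<le> 1 * (1/2)"
    unfolding abs_mult using p u by (intro mult_mono) auto
  then have "\<bar>b\<bar> \<le> 4/3"
    unfolding b_def mult.assoc by linarith
  then have "b\<^sup>2 \<le> (4/3)\<^sup>2" by (metis abs_ge_zero power2_abs power_mono)
  then have "p * b\<^sup>2 \<le> p * (16/9)" using p by (intro mult_left_mono) (auto simp: power2_eq_square)
  then have "2/3 * (1 - p) * (1 + p * b\<^sup>2) \<le> 2/3 * (1 - p) * (1 + p * (16/9))"
    using p by (intro mult_left_mono) auto
  also have "\<dots> \<le> 1"
  proof -
    \<comment> \<open>Completing the square: the quadratic in \<open>p\<close> peaks at 7/32 with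
      value 2/3 + 49/864, below 1. The 16/9 is the square of the bound 4/3 on
      \<open>b\<close>.\<close>
    have "2/3 * (1 - p) * (1 + p * (16/9)) = 1 - 32/27 * (p - 7/32)\<^sup>2 - (1/3 - 49/864)"
      by (simp add: power2_eq_square field_simps)
    then show ?thesis using zero_le_power2[of "p - 7/32"] by linarith
  qed
  finally have "p\<^sup>2 * u\<^sup>2 * (2/3 * (1 - p) * (1 + p * b\<^sup>2)) \<le> p\<^sup>2 * u\<^sup>2 * 1"
    by (intro mult_left_mono) auto
  moreover have "h (h u) = p\<^sup>2 * u + p\<^sup>2 * u\<^sup>2 * (2/3 * (1 - p) * (1 + p * b\<^sup>2))"
  proof -
    have "h u = p * u * b" unfolding h_def b_def by (simp add: algebra_simps power2_eq_square)
    then have "h (h u) = p * h u + 2/3 * p * (1 - p) * (p * u * b)\<^sup>2" by (simp add: h_def)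
    also have "p * h u = p\<^sup>2 * u + p\<^sup>2 * u\<^sup>2 * (2/3 * (1 - p))"
      unfolding h_def by (simp add: algebra_simps power2_eq_square)
    finally have e: "h (h u) = p\<^sup>2 * u + p\<^sup>2 * u\<^sup>2 * (2/3 * (1 - p)) + 2/3 * p * (1 - p) * (p * u * b)\<^sup>2" .
    show ?thesis unfolding e by (simp add: field_simps power2_eq_square)
  qed
  ultimately show ?thesis by (simp add: distrib_left)
qed

section \<open>Exponential moment of the number of monochromatic triangles\<close>

lemma sum_exp_mono_count_le:
  fixes F :: "'a set set" and u :: real
  assumes N: "N > 0" and p: "p = 1 / real N" and K: "K > 0"
    and F: "finite F" "\<And>v. card {S \<in> F. v \<in> S} \<le> K" "\<And>S. S \<in> F \<Longrightarrow> S \<subseteq> V \<and> card S = 3"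
    and V: "finite V" and u: "\<bar>u\<bar> \<le> 1/2"
  shows "(\<Sum>c\<in>PiE V (\<lambda>_. {..<N}). exp (u * real (card {S \<in> F. monochromatic c S}) / real K))
         \<le> real N ^ card V * exp (real (card F) * (p\<^sup>2 * (u + u\<^sup>2)) / real K)"
proof -
  define h where "h x = p * x + 2/3 * p * (1 - p) * x\<^sup>2" for x :: real
  \<comment> \<open>Built backward from the final weight \<open>u\<close>, so \<open>wstep\<close>
    holds with equality for \<open>k\<close> = 1 and 2. Beyond 3 the value stays \<open>u\<close>
    because the sign and size condition ranges over all \<open>k\<close>.\<close>
  define w where "w k = (if k \<le> 1 then h (h u) else if k = 2 then h u else u)" for k :: nat
  have p01: "0 < p" "p \<le> 1" using N p by auto
  have sgn: "(0 \<le> x \<longrightarrow> 0 \<le> h x \<and> h x \<le> x) \<and> (x \<le> 0 \<longrightarrow> x \<le> h x \<and> h x \<le> 0)"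
    if "\<bar>x\<bar> \<le> 1/2" for x
    using exponent_step_bounds[OF p01 that] unfolding h_def by blast
  have hu: "\<bar>h u\<bar> \<le> 1/2" using sgn[OF u] u by linarith
  have w: "(\<forall>k. 0 \<le> w k \<and> w k \<le> 1/2) \<or> (\<forall>k. -1/2 \<le> w k \<and> w k \<le> 0)"
    using sgn[OF u] sgn[OF hu] u by (cases "u \<ge> 0") (auto simp: w_def)
  have fin: "finite S" if "S \<in> F" for S using F(3)[OF that] V finite_subset by auto
  have "(\<Sum>S\<in>F. if monochromatic c (S \<inter> V) then w (card (S \<inter> V)) else 0)
        = u * real (card {S \<in> F. monochromatic c S})" for c :: "'a \<Rightarrow> nat"
  proof -
    have "(\<Sum>S\<in>F. if monochromatic c (S \<inter> V) then w (card (S \<inter> V)) else 0)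
          = (\<Sum>S\<in>F. if monochromatic c S then u else 0)"
    proof (intro sum.cong refl)
      fix S assume "S \<in> F"
      then have "S \<inter> V = S" "card S = 3" using F(3) by auto
      then show "(if monochromatic c (S \<inter> V) then w (card (S \<inter> V)) else 0)
          = (if monochromatic c S then u else 0)" by (simp add: w_def)
    qed
    also have "\<dots> = (\<Sum>S | S \<in> F \<and> monochromatic c S. u)"
      using F(1) by (rule sum.inter_filter[symmetric])
    finally show ?thesis by simp
  qed
  moreover have "(\<Sum>c\<in>PiE V (\<lambda>_. {..<N}).
            exp ((\<Sum>S\<in>F. if monochromatic c (S \<inter> V) then w (card (S \<inter> V)) else 0) / real K))
         \<le> real N ^ card V * exp (real (card F) * w 0 / real K)"
  proof (rule sum_exp_potential_le[where r = 3, OF N p K F(1,2)])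
    show "p * w (Suc k) + 2/3 * p * (1 - p) * (w (Suc k))\<^sup>2 \<le> w k" if "1 \<le> k" "k < 3" for k
    proof -
      have "k = 1 \<or> k = 2" using that by auto
      then show ?thesis by (auto simp: w_def h_def)
    qed
  qed (use F(3) fin w V in \<open>auto simp: w_def\<close>)
  moreover have "exp (real (card F) * w 0 / real K) \<le> exp (real (card F) * (p\<^sup>2 * (u + u\<^sup>2)) / real K)"
    using exponent_two_steps_le[OF p01 u] K
    by (auto simp: w_def h_def intro!: divide_right_mono mult_left_mono)
  ultimately show ?thesis
    using mult_left_mono[of _ _ "real N ^ card V"] by (smt (verit) of_nat_0_le_iff sum.cong zero_le_power)
qed

section \<open>Both tails and the union bound\<close>

theorem theorem3:
  fixes n N :: nat and E :: "nat \<Rightarrow> nat \<Rightarrow> bool" and \<epsilon> d p :: real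
  assumes graph: "simple_graph_on n E"
    and N_pos: "N > 0"
    and p_def: "p = 1 / real N"
    and eps: "0 < \<epsilon>" "\<epsilon> < 1"
    and d_pos: "d > 0"
    and hyp: "p ^ 2 \<ge> 4 * (d + 3) * real (max_vertex_triangles n E) * ln (real n)
                       / (\<epsilon> ^ 2 * real (num_triangles n E))"
  shows "measure_pmf.prob (random_coloring n N)
           {c. \<bar>real (mono_triangles n E c)
                 - measure_pmf.expectation (random_coloring n N) (\<lambda>c. real (mono_triangles n E c))\<bar>
               > \<epsilon> * measure_pmf.expectation (random_coloring n N) (\<lambda>c. real (mono_triangles n E c))}
         \<le> 1 / real n powr d"
proof (cases "num_triangles n E = 0")
  \<comment> \<open>With no triangles the hypothesis contains a division by zero, but the count is
    constantly 0 and the event 0 > 0 is empty.\<close>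
  case True
  have "finite (triangles n E)"
    by (rule finite_subset[of _ "Pow {1..n}"]) (auto simp: triangles_def)
  then have "triangles n E = {}" using True by (simp add: num_triangles_def)
  then show ?thesis by (simp add: mono_triangles_def)
next
  case False
  define F where "F = triangles n E"
  define A where "A = colorings n N"
  define K where "K = max_vertex_triangles n E"
  define T where "T c = real (mono_triangles n E c)" for c
  define \<mu> where "\<mu> = p\<^sup>2 * real (card F)"
  have finF: "finite F"
    unfolding F_def by (rule finite_subset[of _ "Pow {1..n}"]) (auto simp: triangles_def)
  have F3: "S \<subseteq> {1..n} \<and> card S = 3" if "S \<in> F" for S
    using that by (auto simp: F_def triangles_def)
  have T: "T c = real (card {S \<in> F. monochromatic c S})" for c
    by (simp add: T_def mono_triangles_def F_def monochromatic_def)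
  have finA: "finite A" and cardA: "real (card A) = real N ^ n"
    unfolding A_def colorings_def by (auto simp: finite_PiE card_PiE)
  then have A0: "A \<noteq> {}" using N_pos by auto
  have cardF: "card F > 0" using False by (simp add: F_def num_triangles_def)
  then obtain S0 where S0: "S0 \<in> F" by (metis card.empty equals0I less_irrefl)
  have n3: "n \<ge> 3" using F3[OF S0] card_mono[of "{1..n}" S0] by simp
  have vK: "card {S \<in> F. v \<in> S} \<le> K" for v
  proof (cases "v \<in> {1..n}")
    case True
    then show ?thesis unfolding K_def max_vertex_triangles_def F_def by (intro Max_ge) auto
  next
    case False
    then have "{S \<in> F. v \<in> S} = {}" using F3 by blast
    then show ?thesis by (metis card.empty zero_le)
  qed
  obtain v0 where "v0 \<in> S0" using F3[OF S0] by fastforce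
  then have "card {S \<in> F. v0 \<in> S} > 0" using S0 finF by (auto simp: card_gt_0_iff)
  then have K0: "K > 0" using vK[of v0] by linarith
  \<comment> \<open>Linearity of expectation; each triangle contributes \<open>p\<^sup>2\<close>,
    the exponent being 3 - 1.\<close>
  have ET: "measure_pmf.expectation (random_coloring n N) T = \<mu>"
  proof -
    have "(\<Sum>c\<in>A. T c) = (\<Sum>c\<in>A. \<Sum>S\<in>F. of_bool (monochromatic c S))"
      unfolding T using finF by (simp add: Int_def conj_commute)
    also have "\<dots> = (\<Sum>S\<in>F. \<Sum>c\<in>A. of_bool (monochromatic c S))" by (rule sum.swap)
    also have "\<dots> = (\<Sum>S\<in>F. real N ^ n * p\<^sup>2)"
    proof (intro sum.cong refl)
      fix S assume "S \<in> F"
      then have "S \<inter> {1..n} = S" "card S = 3" using F3 by auto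
      then show "(\<Sum>c\<in>A. of_bool (monochromatic c S)) = real N ^ n * p\<^sup>2"
        using sum_monochromatic[OF N_pos, of "{1..n}" S] by (simp add: A_def colorings_def p_def)
    qed
    finally have "(\<Sum>c\<in>A. T c) = real N ^ n * \<mu>" by (simp add: \<mu>_def)
    then show ?thesis
      unfolding random_coloring_def A_def[symmetric]
      using finA A0 N_pos by (simp add: integral_pmf_of_set cardA)
  qed
  \<comment> \<open>Covers both signs of \<open>u\<close>. The moment exponent minus the threshold
    is \<open>(u\<^sup>2 - \<epsilon>\<^sup>2 / 2) * \<mu> / K\<close>; size
    \<open>\<epsilon> / 2\<close> for \<open>u\<close> minimizes
    \<open>u\<^sup>2 - \<epsilon> * \<bar>u\<bar>\<close> and yields the 4 in the exponent.\<close>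
  have tail: "measure_pmf.prob (random_coloring n N) {c. P c} \<le> exp (- (\<epsilon>\<^sup>2 * \<mu> / (4 * real K)))"
    if u: "u\<^sup>2 = \<epsilon>\<^sup>2 / 4" and P: "\<And>c. P c \<Longrightarrow> u * T c \<ge> u * \<mu> + \<epsilon>\<^sup>2 / 2 * \<mu>" for u P
  proof -
    define a where "a = (u * \<mu> + \<epsilon>\<^sup>2 / 2 * \<mu>) / real K"
    have "\<bar>u\<bar> \<le> 1/2"
    proof (rule power2_le_imp_le)
      show "\<bar>u\<bar>\<^sup>2 \<le> (1/2)\<^sup>2" using u eps power_le_one[of \<epsilon> 2] by (simp add: power2_eq_square)
    qed simp
    then have mgf: "(\<Sum>c\<in>A. exp (u * T c / real K))
        \<le> real N ^ n * exp (real (card F) * (p\<^sup>2 * (u + u\<^sup>2)) / real K)"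
      using sum_exp_mono_count_le[OF N_pos p_def K0 finF vK F3, of u]
      by (simp add: T A_def colorings_def)
    have "measure_pmf.prob (random_coloring n N) {c. P c}
          \<le> (\<Sum>c\<in>A. exp (u * T c / real K - a)) / real (card A)"
      unfolding random_coloring_def A_def[symmetric]
      using P K0 by (intro prob_pmf_of_set_exp_le finA A0) (auto simp: a_def divide_right_mono)
    also have "\<dots> = (\<Sum>c\<in>A. exp (u * T c / real K)) / real N ^ n * exp (- a)"
      by (simp add: cardA exp_diff exp_minus sum_divide_distrib field_simps)
    also have "\<dots> \<le> exp (real (card F) * (p\<^sup>2 * (u + u\<^sup>2)) / real K) * exp (- a)"
      using mgf N_pos by (intro mult_right_mono) (auto simp: field_simps)
    also have "\<dots> = exp (real (card F) * (p\<^sup>2 * (u + u\<^sup>2)) / real K - a)"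
      by (simp add: exp_add[symmetric])
    also have "real (card F) * (p\<^sup>2 * (u + u\<^sup>2)) / real K - a = - (\<epsilon>\<^sup>2 * \<mu> / (4 * real K))"
      unfolding a_def \<mu>_def u using K0 by (simp add: field_simps)
    finally show ?thesis .
  qed
  have upper: "measure_pmf.prob (random_coloring n N) {c. T c > \<mu> + \<epsilon> * \<mu>}
               \<le> exp (- (\<epsilon>\<^sup>2 * \<mu> / (4 * real K)))"
  proof (rule tail[of "\<epsilon> / 2"])
    fix c assume "T c > \<mu> + \<epsilon> * \<mu>"
    then have "\<epsilon> / 2 * (\<mu> + \<epsilon> * \<mu>) \<le> \<epsilon> / 2 * T c" using eps by (intro mult_left_mono) auto
    then show "\<epsilon> / 2 * \<mu> + \<epsilon>\<^sup>2 / 2 * \<mu> \<le> \<epsilon> / 2 * T c" by (simp add: algebra_simps power2_eq_square)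
  qed (simp add: power_divide)
  have lower: "measure_pmf.prob (random_coloring n N) {c. T c < \<mu> - \<epsilon> * \<mu>}
               \<le> exp (- (\<epsilon>\<^sup>2 * \<mu> / (4 * real K)))"
  proof (rule tail[of "- \<epsilon> / 2"])
    fix c assume "T c < \<mu> - \<epsilon> * \<mu>"
    then have "\<epsilon> / 2 * T c \<le> \<epsilon> / 2 * (\<mu> - \<epsilon> * \<mu>)" using eps by (intro mult_left_mono) auto
    then show "- \<epsilon> / 2 * \<mu> + \<epsilon>\<^sup>2 / 2 * \<mu> \<le> - \<epsilon> / 2 * T c" by (simp add: algebra_simps power2_eq_square)
  qed (simp add: power_divide)
  have "measure_pmf.prob (random_coloring n N) {c. \<bar>T c - \<mu>\<bar> > \<epsilon> * \<mu>}
        \<le> measure_pmf.prob (random_coloring n N) ({c. T c > \<mu> + \<epsilon> * \<mu>} \<union> {c. T c < \<mu> - \<epsilon> * \<mu>})"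
    by (intro measure_pmf.finite_measure_mono) auto
  also have "\<dots> \<le> measure_pmf.prob (random_coloring n N) {c. T c > \<mu> + \<epsilon> * \<mu>}
                + measure_pmf.prob (random_coloring n N) {c. T c < \<mu> - \<epsilon> * \<mu>}"
    by (rule measure_Un_le) auto
  also have "\<dots> \<le> exp (- (\<epsilon>\<^sup>2 * \<mu> / (4 * real K))) + exp (- (\<epsilon>\<^sup>2 * \<mu> / (4 * real K)))"
    using upper lower by (rule add_mono)
  also have "\<dots> = 2 * exp (- (\<epsilon>\<^sup>2 * \<mu> / (4 * real K)))" by simp
  also have "\<dots> \<le> 2 * exp (- ((d + 3) * ln (real n)))"
  proof -
    have "4 * (d + 3) * real K * ln (real n) \<le> \<epsilon>\<^sup>2 * \<mu>"
      using hyp eps cardF by (simp add: K_def F_def \<mu>_def num_triangles_def field_simps)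
    then have "(d + 3) * ln (real n) \<le> \<epsilon>\<^sup>2 * \<mu> / (4 * real K)"
      using K0 by (simp add: field_simps)
    then show ?thesis by simp
  qed
  also have "\<dots> = 2 * (real n powr (-3) * real n powr (-d))"
    using n3 by (simp add: powr_def exp_add[symmetric] algebra_simps)
  also have "\<dots> = (2 * real n powr (-3)) * real n powr (-d)" by simp
  \<comment> \<open>The surplus 3 in \<open>d + 3\<close> absorbs the factor 2 of the union bound,
    as a triangle forces \<open>n\<close> to be at least 3.\<close>
  also have "\<dots> \<le> 1 * real n powr (-d)"
  proof (intro mult_right_mono)
    have "(2::real) \<le> 3 ^ 3" by simp
    also have "\<dots> \<le> real n ^ 3" using n3 by (intro power_mono) auto
    finally show "2 * real n powr (-3) \<le> 1"
      using n3 by (simp add: powr_minus powr_numeral field_simps)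
  qed simp
  finally show ?thesis
    using ET by (simp add: T_def[abs_def] powr_minus divide_inverse)
qed

end
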